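(* Let $L,M\ge1$ be integers, let $p\in[0,1]$ be a probability and $q=1-p$, with $q\neq1$. Let $\mathcal{U}$ be the first passage time of the cycle trap process with parameters $(p,L,M)$ and, for an integer $N\ge1$, let $\mathcal{T}_N$ be its first passage time under sharp restart at time $N$. Then: (i) When $L\ge M$, $\mathbb{E}[\mathcal{T}_N]\ge\mathbb{E}[\mathcal{U}]$ for all values of $N$. In particular, $L>M$ implies $\mathbb{E}[\mathcal{T}_N]>\mathbb{E}[\mathcal{U}]$. (ii) When $L<M$, beginning at $N=L+1$, every (successive block of) $M+1$ values of $N$ has first $M-L$ values with $\mathbb{E}[\mathcal{T}_N]<\mathbb{E}[\mathcal{U}]$, then one value of $N$ with $\mathbb{E}[\mathcal{T}_N]=\mathbb{E}[\mathcal{U}]$, followed by $L$ values of $N$ with $\mathbb{E}[\mathcal{T}_N]>\mathbb{E}[\mathcal{U}]$.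
   Context: Cycle trap process with parameters $(p,L,M)$: the state space is $\{-L,\ldots,M\}$, the process starts at $0$ and terminates at $-L$. From $0$ it moves to $-1$ with probability $p$ and to $1$ with probability $q=1-p$. From a state $-j$ with $1\le j<L$ it moves to $-j-1$ with probability $1$. From a state $j$ with $1\le j<M$ it moves to $j+1$ with probability $1$, and from $M$ it moves to $0$ with probability $1$. $\mathcal{U}$ is the hitting time of $-L$. Sharp restart at time $N$: the restart time is deterministic, $\mathcal{R}=N$. The first passage time under restart $\mathcal{T}$ is defined recursively by $\mathcal{T}=\mathcal{U}$ if $\mathcal{R}>\mathcal{U}$ and $\mathcal{T}=\mathcal{R}+\mathcal{T}^*$ if $\mathcal{R}\le\mathcal{U}$, where $\mathcal{T}^*$ is a copy of $\mathcal{T}$ with the same distribution, independent of $(\mathcal{U},\mathcal{R})$ (ties count as restarts). Explicitly: let $(\mathcal{U}_k,\mathcal{R}_k)_{k\ge1}$ be i.i.d. copies of $(\mathcal{U},\mathcal{R})$ and $\kappa=\inf\{k\ge1:\mathcal{R}_k>\mathcal{U}_k\}$; then $\mathcal{T}=\sum_{j<\kappa}\mathcal{R}_j+\mathcal{U}_\kappa$ if $\kappa<\infty$, and $\mathcal{T}=\infty$ if $\kappa=\infty$. In particular $\mathbb{E}[\mathcal{T}_N]=\infty$ when $N\le L$ (preemptive restart).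
   Formalization: The strict inequalities for N > L are stated only for q ≠ 0, since for q = 0 (p = 1) one has U = L = T_N for every N > L, so E[T_N] = E[U] and they fail; the strict claim for N ≤ L, the non-strict claim and the equality are kept for q = 0. *)

theory Defs
  imports "HOL-Probability.Probability"
begin

definition markov_chain ::
  "'a measure \<Rightarrow> ('s \<Rightarrow> 's pmf) \<Rightarrow> 's \<Rightarrow> (nat \<Rightarrow> 'a \<Rightarrow> 's) \<Rightarrow> bool" where
  "markov_chain \<Omega> K s\<^sub>0 X \<longleftrightarrow>
     prob_space \<Omega> \<and>
     (\<forall>n. X n \<in> measurable \<Omega> (count_space UNIV)) \<and>
     (AE \<omega> in \<Omega>. X 0 \<omega> = s\<^sub>0) \<and>
     (\<forall>n s y. \<P>(\<omega> in \<Omega>. \<forall>i\<le>n. X i \<omega> = s i) > 0 \<longrightarrow>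
        \<P>(\<omega> in \<Omega>. X (Suc n) \<omega> = y \<bar> \<forall>i\<le>n. X i \<omega> = s i) = pmf (K (s n)) y)"

(* The chain lives on {- int L .. int M}. The values at integers outside this set are never
   used, since the chain starts at 0. Termination at - int L is modelled by absorption. *)
definition cycle_trap_kernel :: "real \<Rightarrow> nat \<Rightarrow> nat \<Rightarrow> int \<Rightarrow> int pmf" where
  "cycle_trap_kernel p L M x =
     (if x = 0 then map_pmf (\<lambda>b. if b then - 1 else 1) (bernoulli_pmf p)
      else if x \<le> - int L then return_pmf x
      else if x < 0 then return_pmf (x - 1)
      else if x < int M then return_pmf (x + 1)
      else return_pmf 0)"

abbreviation cycle_trap_process ::
  "'a measure \<Rightarrow> real \<Rightarrow> nat \<Rightarrow> nat \<Rightarrow> (nat \<Rightarrow> 'a \<Rightarrow> int) \<Rightarrow> bool" where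
  "cycle_trap_process \<Omega> p L M X \<equiv> markov_chain \<Omega> (cycle_trap_kernel p L M) 0 X"

(* The infimum of the empty set is \<infinity>. *)
definition hitting_time :: "(nat \<Rightarrow> 'a \<Rightarrow> 's) \<Rightarrow> 's \<Rightarrow> 'a \<Rightarrow> enat" where
  "hitting_time X a \<omega> = (INF n\<in>{n. X n \<omega> = a}. enat n)"

(* The k-th attempt has completion time u k and restart time r k, with k counted from 0. *)
definition restart_time :: "(nat \<Rightarrow> enat) \<Rightarrow> (nat \<Rightarrow> enat) \<Rightarrow> enat" where
  "restart_time u r =
     (if \<exists>k. r k > u k
      then let \<kappa> = LEAST k. r k > u k in (\<Sum>j<\<kappa>. r j) + u \<kappa>
      else \<infinity>)"

definition iid_copies ::
  "'b measure \<Rightarrow> (nat \<Rightarrow> 'b \<Rightarrow> 'c) \<Rightarrow> 'a measure \<Rightarrow> ('a \<Rightarrow> 'c) \<Rightarrow> 'c measure \<Rightarrow> bool" where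
  "iid_copies \<Omega>' Y \<Omega> Z S \<longleftrightarrow>
     prob_space \<Omega>' \<and>
     prob_space.indep_vars \<Omega>' (\<lambda>_. S) Y UNIV \<and>
     (\<forall>k. distr \<Omega>' S (Y k) = distr \<Omega> S Z)"

(* T, on the probability space \<Omega>', is a first passage time under restart for the completion
   time U and restart time R, which are given jointly on the probability space \<Omega>. *)
definition passage_time_under_restart ::
  "'a measure \<Rightarrow> ('a \<Rightarrow> enat) \<Rightarrow> ('a \<Rightarrow> enat) \<Rightarrow> 'b measure \<Rightarrow> ('b \<Rightarrow> enat) \<Rightarrow> bool" where
  "passage_time_under_restart \<Omega> U R \<Omega>' T \<longleftrightarrow>
     (\<exists>Us Rs. iid_copies \<Omega>' (\<lambda>k \<omega>. (Us k \<omega>, Rs k \<omega>)) \<Omega> (\<lambda>\<omega>. (U \<omega>, R \<omega>)) (count_space UNIV) \<and>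
        T = (\<lambda>\<omega>. restart_time (\<lambda>k. Us k \<omega>) (\<lambda>k. Rs k \<omega>)))"

abbreviation passage_time_under_sharp_restart ::
  "'a measure \<Rightarrow> ('a \<Rightarrow> enat) \<Rightarrow> nat \<Rightarrow> 'b measure \<Rightarrow> ('b \<Rightarrow> enat) \<Rightarrow> bool" where
  "passage_time_under_sharp_restart \<Omega> U N \<Omega>' T \<equiv>
     passage_time_under_restart \<Omega> U (\<lambda>_. enat N) \<Omega>' T"

definition mean :: "'a measure \<Rightarrow> ('a \<Rightarrow> enat) \<Rightarrow> ennreal" where
  "mean \<Omega> T = (\<integral>\<^sup>+\<omega>. ennreal_of_enat (T \<omega>) \<partial>\<Omega>)"

end

theory Submission
  imports Defs
begin

text \<open>
  The chain makes a geometric number \<open>G\<close> of cycles of length \<open>M + 1\<close> before it walks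
  straight down to \<open>- L\<close>, so \<open>\<U> = L + G (M + 1)\<close>. Under restart, attempt \<open>k\<close> takes place iff all
  earlier ones were restarted, and it then contributes \<open>min \<U>\<^sub>k \<R>\<^sub>k\<close>; hence
  \<open>E \<T> = (\<Sum>k. s ^ k) * E (min \<U> \<R>)\<close> with \<open>s = P(\<R> \<le> \<U>)\<close>. For
  \<open>N = L + 1 + b (M + 1) + r\<close> with \<open>r \<le> M\<close> this gives \<open>s = q ^ (b + 1)\<close>, and the memoryless property
  of \<open>G\<close> yields \<open>E \<T> - E \<U> = s (L + r - M) / (1 - s)\<close>, whose sign is that of \<open>r - (M - L)\<close>.
\<close>

section \<open>Hitting times and path probabilities\<close>

text \<open>A nonempty set of indices attains its infimum at its least element, while the empty set
  gives \<infinity>, which is no \<open>enat n\<close>.\<close>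

lemma hitting_time_eq_enat_iff:
  "hitting_time X a \<omega> = enat n \<longleftrightarrow> X n \<omega> = a \<and> (\<forall>j<n. X j \<omega> \<noteq> a)"
proof (cases "\<exists>k. X k \<omega> = a")
  case True
  define m where "m = (LEAST k. X k \<omega> = a)"
  have m: "X m \<omega> = a" "\<And>k. X k \<omega> = a \<Longrightarrow> m \<le> k"
    using True by (auto simp: m_def intro: LeastI Least_le)
  have "hitting_time X a \<omega> = enat m"
    unfolding hitting_time_def by (rule antisym) (auto intro!: INF_lower2[of m] INF_greatest m)
  then show ?thesis using m by (auto simp: not_le[symmetric] intro: antisym)
next
  case False
  then show ?thesis by (auto simp: hitting_time_def top_enat_def)
qed

lemma hitting_time_eq_infinity_iff: "hitting_time X a \<omega> = \<infinity> \<longleftrightarrow> (\<forall>n. X n \<omega> \<noteq> a)"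
proof
  assume inf: "hitting_time X a \<omega> = \<infinity>"
  show "\<forall>n. X n \<omega> \<noteq> a"
  proof (intro allI notI)
    fix n assume "X n \<omega> = a"
    then have "hitting_time X a \<omega> \<le> enat n"
      unfolding hitting_time_def by (auto intro: INF_lower)
    with inf show False by simp
  qed
qed (auto simp: hitting_time_def top_enat_def)

lemma measurable_hitting_time:
  assumes [measurable]: "\<And>n. X n \<in> measurable \<Omega> (count_space UNIV)"
  shows "hitting_time X a \<in> measurable \<Omega> (count_space UNIV)"
  unfolding measurable_count_space_eq2_countable
proof (intro conjI ballI)
  fix t :: enat
  show "hitting_time X a -` {t} \<inter> space \<Omega> \<in> sets \<Omega>"
  proof (cases t)
    case (enat n)
    have "hitting_time X a -` {t} \<inter> space \<Omega> =
        {\<omega> \<in> space \<Omega>. X n \<omega> = a \<and> (\<forall>j<n. X j \<omega> \<noteq> a)}"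
      by (auto simp: enat hitting_time_eq_enat_iff)
    also have "\<dots> \<in> sets \<Omega>" by measurable
    finally show ?thesis .
  next
    case infinity
    have "hitting_time X a -` {t} \<inter> space \<Omega> = {\<omega> \<in> space \<Omega>. \<forall>n. X n \<omega> \<noteq> a}"
      by (auto simp: infinity hitting_time_eq_infinity_iff)
    also have "\<dots> \<in> sets \<Omega>" by measurable
    finally show ?thesis .
  qed
qed auto

text \<open>The transition law is known only after histories of positive probability. After a null
  history both sides vanish, so the product formula holds for every path from the start
  state.\<close>

lemma markov_chain_path_prob:
  assumes "markov_chain \<Omega> K s\<^sub>0 X" and "s 0 = s\<^sub>0"
  shows "\<P>(\<omega> in \<Omega>. \<forall>i\<le>n. X i \<omega> = s i) = (\<Prod>i<n. pmf (K (s i)) (s (Suc i)))"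
proof (induction n)
  case 0
  interpret prob_space \<Omega> using assms by (simp add: markov_chain_def)
  have [measurable]: "X 0 \<in> measurable \<Omega> (count_space UNIV)"
    using assms by (simp add: markov_chain_def)
  have "AE \<omega> in \<Omega>. X 0 \<omega> = s 0" using assms by (simp add: markov_chain_def)
  then have "\<P>(\<omega> in \<Omega>. X 0 \<omega> = s 0) = 1"
    by (subst prob_Collect_eq_1) auto
  then show ?case by simp
next
  case (Suc n)
  interpret prob_space \<Omega> using assms by (simp add: markov_chain_def)
  have X[measurable]: "X i \<in> measurable \<Omega> (count_space UNIV)" for i
    using assms by (simp add: markov_chain_def)
  let ?A = "\<P>(\<omega> in \<Omega>. \<forall>i\<le>n. X i \<omega> = s i)"
  have eq: "(\<forall>i\<le>Suc n. X i \<omega> = s i) \<longleftrightarrow> X (Suc n) \<omega> = s (Suc n) \<and> (\<forall>i\<le>n. X i \<omega> = s i)" for \<omega>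
    by (auto simp: le_Suc_eq)
  show ?case
  proof (cases "?A > 0")
    case True
    then have "\<P>(\<omega> in \<Omega>. X (Suc n) \<omega> = s (Suc n) \<bar> \<forall>i\<le>n. X i \<omega> = s i)
        = pmf (K (s n)) (s (Suc n))"
      using assms unfolding markov_chain_def by blast
    then have "\<P>(\<omega> in \<Omega>. \<forall>i\<le>Suc n. X i \<omega> = s i) = ?A * pmf (K (s n)) (s (Suc n))"
      using True by (simp add: cond_prob_def eq field_simps)
    then show ?thesis using Suc by simp
  next
    case False
    then have A: "?A = 0" by (simp add: zero_less_measure_iff)
    have "\<P>(\<omega> in \<Omega>. \<forall>i\<le>Suc n. X i \<omega> = s i) \<le> ?A"
      by (rule finite_measure_mono) (auto simp: eq)
    then have "\<P>(\<omega> in \<Omega>. \<forall>i\<le>Suc n. X i \<omega> = s i) = 0"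
      unfolding A by (simp add: measure_le_0_iff)
    then show ?thesis using Suc A by simp
  qed
qed

section \<open>The law of the first passage time of the cycle trap process\<close>

text \<open>This is the trajectory with exactly \<open>g\<close> cycles before the descent. At
  \<open>i = g * (M + 1)\<close> the second branch already applies and gives \<open>0\<close>. Only
  indices up to \<open>L + g * (M + 1)\<close> matter below.\<close>

definition cycle_trap_path :: "nat \<Rightarrow> nat \<Rightarrow> nat \<Rightarrow> int" where
  "cycle_trap_path M g i =
     (if i < g * (M + 1) then int (i mod (M + 1)) else int (g * (M + 1)) - int i)"

text \<open>Only departures from \<open>0\<close> are random. Each cycle opens with a factor
  \<open>1 - p\<close>, the descent opens with \<open>p\<close>, and all other factors are
  \<open>1\<close>.\<close>

lemma cycle_trap_path_prob:
  assumes "L \<ge> 1" and "M \<ge> 1" and "p \<in> {0..1}"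
  shows "(\<Prod>i<L + g * (M + 1). pmf (cycle_trap_kernel p L M (cycle_trap_path M g i))
            (cycle_trap_path M g (Suc i))) = (1 - p) ^ g * p"
    (is "prod ?f _ = _")
proof -
  let ?k = "M + 1"
  have inj: "inj (\<lambda>b::bool. if b then - 1 else 1 :: int)" by (auto simp: inj_on_def split: if_splits)
  have up: "pmf (map_pmf (\<lambda>b. if b then - 1 else 1 :: int) (bernoulli_pmf p)) 1 = 1 - p"
    using pmf_map_inj'[OF inj, of _ False] assms by simp
  have down: "pmf (map_pmf (\<lambda>b. if b then - 1 else 1 :: int) (bernoulli_pmf p)) (- 1) = p"
    using pmf_map_inj'[OF inj, of _ True] assms by simp
  have cycle: "?f (m * ?k + r) = (if r = 0 then 1 - p else 1)" if "m < g" "r < ?k" for m r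
  proof -
    have "m * ?k + ?k \<le> g * ?k"
      using mult_le_mono1[of "Suc m" g ?k] that by simp
    then have lt: "m * ?k + r < g * ?k" and le: "Suc (m * ?k + r) \<le> g * ?k" using that by auto
    have here: "cycle_trap_path M g (m * ?k + r) = int r"
      using lt that unfolding cycle_trap_path_def by (simp only: mod_mult_self3 mod_less if_True)
    have mod: "Suc (m * ?k + r) mod ?k = (if r = M then 0 else Suc r)"
    proof -
      have "Suc (m * ?k + r) mod ?k = Suc r mod ?k"
        by (metis add_Suc_right mod_mult_self3)
      then show ?thesis using that by auto
    qed
    \<comment> \<open>The end of the last cycle is a separate case, because there the path
      definition has switched to its descent branch.\<close>
    have there: "cycle_trap_path M g (Suc (m * ?k + r)) = (if r = M then 0 else int r + 1)"
    proof (cases "Suc (m * ?k + r) = g * ?k")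
      case True
      have "r = M" using mod unfolding True mod_mult_self2_is_0 by (simp split: if_splits)
      then show ?thesis unfolding cycle_trap_path_def True by simp
    next
      case False
      then have "Suc (m * ?k + r) < g * ?k" using le by linarith
      then show ?thesis unfolding cycle_trap_path_def mod by simp
    qed
    show ?thesis
      unfolding here there using that assms by (auto simp: cycle_trap_kernel_def up)
  qed
  have descent: "?f (g * ?k + r) = (if r = 0 then p else 1)" if "r < L" for r
  proof -
    have "cycle_trap_path M g (g * ?k + r) = - int r"
      "cycle_trap_path M g (Suc (g * ?k + r)) = - int r - 1"
      by (simp_all add: cycle_trap_path_def)
    then show ?thesis using that assms by (auto simp: cycle_trap_kernel_def down)
  qed
  \<comment> \<open>A stretch whose only nontrivial factor is its first one; this serves both the
    cycles and the descent.\<close>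
  have block: "prod ?f {a..<a + n} = x"
    if "\<And>r. r < n \<Longrightarrow> ?f (a + r) = (if r = 0 then x else 1)" "n \<ge> 1" for a n x
  proof -
    have "prod ?f {a..<a + n} = (\<Prod>r<n. ?f (a + r))"
      using prod.shift_bounds_nat_ivl[of ?f 0 a n] by (simp add: lessThan_atLeast0 add.commute)
    also have "\<dots> = (\<Prod>r<n. if r = 0 then x else 1)" using that by (intro prod.cong) auto
    also have "\<dots> = x" using that by (simp add: prod.delta)
    finally show ?thesis .
  qed
  have "prod ?f {..<L + g * ?k} = prod ?f {0..<g * ?k} * prod ?f {g * ?k..<g * ?k + L}"
    by (subst prod.atLeastLessThan_concat) (auto simp: lessThan_atLeast0 add.commute)
  also have "prod ?f {g * ?k..<g * ?k + L} = p" by (intro block descent assms)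
  also have "prod ?f {0..<g * ?k} = (\<Prod>m<g. prod ?f {m * ?k..<m * ?k + ?k})"
    using prod.nat_group[of ?f ?k g] by (simp only: lessThan_atLeast0)
  also have "\<dots> = (\<Prod>m<g. 1 - p)" by (intro prod.cong block cycle) auto
  finally show ?thesis by simp
qed

text \<open>The cycles stay at nonnegative states, hence above \<open>- int L\<close> as
  \<open>L \<ge> 1\<close>, and the descent takes exactly \<open>L\<close> steps.\<close>

lemma hitting_time_cycle_trap_path:
  assumes "L \<ge> 1" and "\<forall>i\<le>L + g * (M + 1). X i \<omega> = cycle_trap_path M g i"
  shows "hitting_time X (- int L) \<omega> = enat (L + g * (M + 1))"
  unfolding hitting_time_eq_enat_iff
proof (intro conjI allI impI)
  show "X (L + g * (M + 1)) \<omega> = - int L" using assms by (simp add: cycle_trap_path_def)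
next
  fix j assume j: "j < L + g * (M + 1)"
  have "cycle_trap_path M g j > - int L"
  proof (cases "j < g * (M + 1)")
    case False
    then show ?thesis using j by (simp only: cycle_trap_path_def if_False)
  qed (use assms(1) in \<open>auto simp: cycle_trap_path_def intro: less_le_trans[of _ 0]\<close>)
  then show "X j \<omega> \<noteq> - int L" using assms(2) j by auto
qed

text \<open>Both measures have total mass \<open>1\<close>, so pointwise domination forces equality.\<close>

lemma measure_pmf_eqI_dominated:
  fixes D :: "'c::countable measure"
  assumes "prob_space D" and [simp]: "sets D = UNIV"
    and le: "\<And>x. pmf P x \<le> measure D {x}"
  shows "D = measure_pmf P"
proof (rule measure_eqI)
  interpret D: prob_space D by fact
  have spD: "space D = UNIV" using sets_eq_imp_space_eq[of D "count_space UNIV"] by simp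
  have mono: "measure_pmf.prob P A \<le> measure D A" for A
  proof -
    have "emeasure (measure_pmf P) A = (\<integral>\<^sup>+x. emeasure (measure_pmf P) {x} \<partial>count_space A)"
      by (intro emeasure_countable_singleton) auto
    also have "\<dots> \<le> (\<integral>\<^sup>+x. emeasure D {x} \<partial>count_space A)"
      using le by (intro nn_integral_mono)
        (auto simp: emeasure_pmf_single D.emeasure_eq_measure intro: ennreal_leI)
    also have "\<dots> = emeasure D A"
      by (intro emeasure_countable_singleton[symmetric]) auto
    finally show ?thesis
      by (simp add: measure_pmf.emeasure_eq_measure D.emeasure_eq_measure)
  qed
  fix A assume "A \<in> sets D"
  have "measure_pmf.prob P (- A) = 1 - measure_pmf.prob P A" "measure D (- A) = 1 - measure D A"
    using measure_pmf.prob_compl[of A P] D.prob_compl[of A] spD by (auto simp: Compl_eq_Diff_UNIV)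
  then have "measure D A = measure_pmf.prob P A"
    using mono[of A] mono[of "- A"] by simp
  then show "emeasure D A = emeasure (measure_pmf P) A"
    by (simp add: measure_pmf.emeasure_eq_measure D.emeasure_eq_measure)
qed simp

text \<open>A lower bound for each atom suffices: the path with \<open>g\<close> cycles alone gives
  its hitting time the geometric weight of \<open>g\<close>. These weights already sum to
  \<open>1\<close>, so no mass is left for other values, \<infinity> included.\<close>

lemma distr_hitting_time_cycle_trap:
  assumes L: "L \<ge> 1" and M: "M \<ge> 1" and p: "p \<in> {0<..1}"
    and proc: "cycle_trap_process \<Omega> p L M X"
  shows "distr \<Omega> (count_space UNIV) (hitting_time X (- int L)) =
    measure_pmf (map_pmf (\<lambda>g. enat (L + g * (M + 1))) (geometric_pmf p))"
proof (rule measure_pmf_eqI_dominated)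
  interpret prob_space \<Omega> using proc by (simp add: markov_chain_def)
  let ?U = "hitting_time X (- int L)" and ?h = "\<lambda>g. enat (L + g * (M + 1))"
  have U[measurable]: "?U \<in> measurable \<Omega> (count_space UNIV)"
    using proc by (intro measurable_hitting_time) (simp add: markov_chain_def)
  show "prob_space (distr \<Omega> (count_space UNIV) ?U)" by (rule prob_space_distr) fact
  \<comment> \<open>Injectivity lets each atom of the image law carry a single geometric
    weight.\<close>
  have inj: "inj ?h"
  proof (rule injI)
    fix g g' assume "?h g = ?h g'"
    then have "g * (M + 1) = g' * (M + 1)" by simp
    then show "g = g'" by (simp only: mult_cancel2) simp
  qed
  fix t
  show "pmf (map_pmf ?h (geometric_pmf p)) t \<le> measure (distr \<Omega> (count_space UNIV) ?U) {t}"
  proof (cases "t \<in> range ?h")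
    case True
    then obtain g where t: "t = ?h g" by auto
    have "pmf (map_pmf ?h (geometric_pmf p)) t = (1 - p) ^ g * p"
      unfolding t pmf_map_inj'[OF inj] using p by simp
    also have "\<dots> = \<P>(\<omega> in \<Omega>. \<forall>i\<le>L + g * (M + 1). X i \<omega> = cycle_trap_path M g i)"
    proof (subst markov_chain_path_prob[OF proc])
      show "cycle_trap_path M g 0 = 0" by (auto simp: cycle_trap_path_def)
    qed (rule cycle_trap_path_prob[OF L M, symmetric], use p in auto)
    also have "\<dots> \<le> \<P>(\<omega> in \<Omega>. ?U \<omega> = t)"
      using hitting_time_cycle_trap_path[OF L, of g M X]
      by (intro finite_measure_mono) (auto simp: t)
    also have "\<dots> = measure (distr \<Omega> (count_space UNIV) ?U) {t}"
      by (subst measure_distr) (auto intro!: arg_cong[of _ _ prob])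
    finally show ?thesis .
  next
    case False
    then have "pmf (map_pmf ?h (geometric_pmf p)) t = 0"
      unfolding pmf_eq_0_set_pmf set_map_pmf by blast
    then show ?thesis by (simp only: measure_nonneg)
  qed
qed simp

section \<open>The mean first passage time under restart\<close>

text \<open>Attempt \<open>k\<close> counts iff all earlier ones were restarted, and then costs
  \<open>r k\<close> if restarted and \<open>u k\<close> if successful; both are the minimum. If no
  attempt succeeds, positive restart times make every term at least \<open>1\<close>, and the series
  diverges.\<close>

lemma restart_time_eq_suminf:
  assumes "\<And>k. r k > 0"
  shows "ennreal_of_enat (restart_time u r) =
    (\<Sum>k. if \<forall>j<k. r j \<le> u j then ennreal_of_enat (min (u k) (r k)) else 0)"
    (is "_ = suminf ?f")
proof (cases "\<exists>k. r k > u k")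
  case True
  define \<kappa> where "\<kappa> = (LEAST k. r k > u k)"
  have \<kappa>: "r \<kappa> > u \<kappa>" "\<And>j. j < \<kappa> \<Longrightarrow> r j \<le> u j"
    using LeastI_ex[OF True] not_less_Least[of _ "\<lambda>k. r k > u k"]
    unfolding \<kappa>_def by (simp_all only: not_less)
  \<comment> \<open>The success at \<open>\<kappa>\<close> violates the condition on earlier
    attempts for every later index.\<close>
  have zero: "?f k = 0" if "k > \<kappa>" for k
    using \<kappa>(1) that by (auto simp: not_le)
  have "suminf ?f = (\<Sum>k\<in>{..<Suc \<kappa>}. ?f k)"
    by (rule suminf_finite) (use zero in auto)
  also have "\<dots> = (\<Sum>k<\<kappa>. ?f k) + ?f \<kappa>" by simp
  also have "(\<Sum>k<\<kappa>. ?f k) = (\<Sum>k<\<kappa>. ennreal_of_enat (r k))"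
    using \<kappa>(2) by (intro sum.cong) (auto simp: min_absorb2)
  also have "?f \<kappa> = ennreal_of_enat (u \<kappa>)"
    using \<kappa> by (simp add: min_absorb1)
  finally show ?thesis
    using True by (simp add: restart_time_def \<kappa>_def Let_def)
next
  case False
  have f: "?f k \<ge> 1" for k
  proof -
    have "(1::enat) \<le> r k" using assms[of k] by (simp add: ileI1 one_eSuc)
    then have "ennreal_of_enat 1 \<le> ennreal_of_enat (r k)" by (simp only: ennreal_of_enat_le_iff)
    then show ?thesis using False by (simp add: not_less min_absorb2)
  qed
  have "of_nat n \<le> suminf ?f" for n
  proof -
    have "of_nat n = (\<Sum>k<n. 1::ennreal)" by simp
    also have "\<dots> \<le> (\<Sum>k<n. ?f k)" by (intro sum_mono f)
    also have "\<dots> \<le> suminf ?f" by (intro sum_le_suminf) auto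
    finally show ?thesis .
  qed
  then have "\<not> suminf ?f < \<infinity>"
    using ennreal_Ex_less_of_nat[of "suminf ?f"] leD by fastforce
  then have "suminf ?f = \<infinity>" by (simp add: not_less top_unique)
  then show ?thesis using False by (simp add: restart_time_def)
qed

text \<open>Integrate the series termwise. Its \<open>k\<close>-th term is a product of restart
  indicators of attempts before \<open>k\<close> and the cost of attempt \<open>k\<close>, so
  independence across attempts factorizes the integral. Within one attempt \<open>U\<close> and
  \<open>R\<close> may be dependent.\<close>

lemma mean_passage_time_under_restart:
  assumes "prob_space \<Omega>"
    and U[measurable]: "U \<in> measurable \<Omega> (count_space UNIV)"
    and R[measurable]: "R \<in> measurable \<Omega> (count_space UNIV)"
    and pos: "AE \<omega> in \<Omega>. R \<omega> > 0"
    and restart: "passage_time_under_restart \<Omega> U R \<Omega>' T"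
  shows "mean \<Omega>' T =
    (\<Sum>k. emeasure \<Omega> {\<omega> \<in> space \<Omega>. R \<omega> \<le> U \<omega>} ^ k) * mean \<Omega> (\<lambda>\<omega>. min (U \<omega>) (R \<omega>))"
proof -
  let ?S = "count_space (UNIV :: (enat \<times> enat) set)"
  obtain Us Rs where iid: "iid_copies \<Omega>' (\<lambda>k \<omega>. (Us k \<omega>, Rs k \<omega>)) \<Omega> (\<lambda>\<omega>. (U \<omega>, R \<omega>)) ?S"
    and T: "T = (\<lambda>\<omega>. restart_time (\<lambda>k. Us k \<omega>) (\<lambda>k. Rs k \<omega>))"
    using restart by (auto simp: passage_time_under_restart_def)
  define Y where "Y k \<omega> = (Us k \<omega>, Rs k \<omega>)" for k \<omega>
  define Z where "Z \<omega> = (U \<omega>, R \<omega>)" for \<omega>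
  interpret \<Omega>': prob_space \<Omega>' using iid by (simp add: iid_copies_def)
  have indep: "\<Omega>'.indep_vars (\<lambda>_. ?S) Y UNIV" and Y_distr: "distr \<Omega>' ?S (Y k) = distr \<Omega> ?S Z" for k
    using iid by (simp_all add: iid_copies_def Y_def[abs_def] Z_def[abs_def])
  have Y[measurable]: "Y k \<in> measurable \<Omega>' ?S" for k
    using indep by (simp add: \<Omega>'.indep_vars_def)
  have Z[measurable]: "Z \<in> measurable \<Omega> ?S"
    using measurable_Pair[OF U R]
    by (simp add: Z_def[abs_def] pair_measure_countable)
  \<comment> \<open>Equality in law moves every expectation about a single attempt back to
    \<Omega>.\<close>
  have transfer: "(\<integral>\<^sup>+\<omega>. h (Y k \<omega>) \<partial>\<Omega>') = (\<integral>\<^sup>+\<omega>. h (Z \<omega>) \<partial>\<Omega>)" for h k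
    using nn_integral_distr[of "Y k" \<Omega>' ?S h] nn_integral_distr[of Z \<Omega> ?S h]
    by (simp add: Y_distr)
  \<comment> \<open>\<open>B\<close> is the restart event, ties included; \<open>f k\<close> packs
    the factors of the \<open>k\<close>-th term into one family indexed by attempts.\<close>
  define B where "B = {(u, r). r \<le> (u :: enat)}"
  define c where "c x = ennreal_of_enat (min (fst x) (snd x))" for x :: "enat \<times> enat"
  define f where "f k i x = (if i < k then indicator B x else c x)" for k i :: nat and x
  have "AE \<omega> in \<Omega>'. Rs k \<omega> > 0" for k
  proof -
    have "AE x in distr \<Omega> ?S Z. snd x > 0"
      using pos by (subst AE_distr_iff) (auto simp: Z_def)
    then have "AE x in distr \<Omega>' ?S (Y k). snd x > 0" by (simp only: Y_distr)
    then show ?thesis by (subst (asm) AE_distr_iff) (auto simp: Y_def)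
  qed
  then have "AE \<omega> in \<Omega>'. \<forall>k. Rs k \<omega> > 0" by (simp add: AE_all_countable)
  then have "AE \<omega> in \<Omega>'. ennreal_of_enat (T \<omega>) = (\<Sum>k. \<Prod>i\<le>k. f k i (Y i \<omega>))"
  proof eventually_elim
    case (elim \<omega>)
    have "(\<Prod>i\<le>k. f k i (Y i \<omega>)) =
        (if \<forall>j<k. Rs j \<omega> \<le> Us j \<omega> then ennreal_of_enat (min (Us k \<omega>) (Rs k \<omega>)) else 0)" for k
    proof -
      have "(\<Prod>i\<le>k. f k i (Y i \<omega>)) = (\<Prod>i<k. f k i (Y i \<omega>)) * f k k (Y k \<omega>)"
        by (simp add: lessThan_Suc_atMost[symmetric])
      also have "(\<Prod>i<k. f k i (Y i \<omega>)) = (\<Prod>i<k. indicator B (Y i \<omega>))"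
        by (intro prod.cong) (auto simp: f_def)
      also have "\<dots> = (if \<forall>j<k. Rs j \<omega> \<le> Us j \<omega> then 1 else 0)"
      proof (cases "\<forall>j<k. Rs j \<omega> \<le> Us j \<omega>")
        case False
        then have "\<exists>i\<in>{..<k}. indicator B (Y i \<omega>) = (0 :: ennreal)"
          by (auto simp: B_def Y_def indicator_def)
        with False show ?thesis by (simp add: prod_zero)
      qed (simp add: B_def Y_def)
      finally have *: "(\<Prod>i\<le>k. f k i (Y i \<omega>)) =
        (if \<forall>j<k. Rs j \<omega> \<le> Us j \<omega> then 1 else 0) * f k k (Y k \<omega>)" .
      show ?thesis unfolding * by (auto simp: f_def c_def Y_def)
    qed
    then show ?case using restart_time_eq_suminf[of "\<lambda>k. Rs k \<omega>" "\<lambda>k. Us k \<omega>"] elim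
      by (simp add: T)
  qed
  then have "mean \<Omega>' T = (\<integral>\<^sup>+\<omega>. (\<Sum>k. \<Prod>i\<le>k. f k i (Y i \<omega>)) \<partial>\<Omega>')"
    unfolding mean_def by (rule nn_integral_cong_AE)
  also have "\<dots> = (\<Sum>k. \<integral>\<^sup>+\<omega>. (\<Prod>i\<le>k. f k i (Y i \<omega>)) \<partial>\<Omega>')"
  proof (rule nn_integral_suminf)
    fix k
    have "(\<lambda>\<omega>. f k i (Y i \<omega>)) \<in> borel_measurable \<Omega>'" for i
      by (rule measurable_compose[OF Y]) simp
    then show "(\<lambda>\<omega>. \<Prod>i\<le>k. f k i (Y i \<omega>)) \<in> borel_measurable \<Omega>'" by measurable
  qed
  also have "\<dots> = (\<Sum>k. emeasure \<Omega> {\<omega> \<in> space \<Omega>. R \<omega> \<le> U \<omega>} ^ k * mean \<Omega> (\<lambda>\<omega>. min (U \<omega>) (R \<omega>)))"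
  proof (rule suminf_cong)
    fix k
    have "\<Omega>'.indep_vars (\<lambda>_. borel) (\<lambda>i \<omega>. f k i (Y i \<omega>)) {..k}"
      by (rule \<Omega>'.indep_vars_compose2[OF \<Omega>'.indep_vars_subset[OF indep]]) auto
    then have "(\<integral>\<^sup>+\<omega>. (\<Prod>i\<le>k. f k i (Y i \<omega>)) \<partial>\<Omega>') = (\<Prod>i\<le>k. \<integral>\<^sup>+\<omega>. f k i (Z \<omega>) \<partial>\<Omega>)"
      by (subst \<Omega>'.indep_vars_nn_integral) (auto simp: transfer)
    also have "\<dots> = (\<Prod>i<k. \<integral>\<^sup>+\<omega>. f k i (Z \<omega>) \<partial>\<Omega>) * (\<integral>\<^sup>+\<omega>. f k k (Z \<omega>) \<partial>\<Omega>)"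
      by (simp add: lessThan_Suc_atMost[symmetric])
    also have "(\<Prod>i<k. \<integral>\<^sup>+\<omega>. f k i (Z \<omega>) \<partial>\<Omega>) = (\<Prod>i<k. emeasure \<Omega> {\<omega> \<in> space \<Omega>. R \<omega> \<le> U \<omega>})"
    proof (rule prod.cong)
      fix i assume i: "i \<in> {..<k}"
      have "Z -` B \<inter> space \<Omega> \<in> sets \<Omega>" by (rule measurable_sets[OF Z]) simp
      moreover have "Z -` B \<inter> space \<Omega> = {\<omega> \<in> space \<Omega>. R \<omega> \<le> U \<omega>}"
        by (auto simp: Z_def B_def)
      ultimately have "(\<integral>\<^sup>+\<omega>. indicator {\<omega> \<in> space \<Omega>. R \<omega> \<le> U \<omega>} \<omega> \<partial>\<Omega>) =
          emeasure \<Omega> {\<omega> \<in> space \<Omega>. R \<omega> \<le> U \<omega>}"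
        by (intro nn_integral_indicator) simp
      moreover have "(\<integral>\<^sup>+\<omega>. f k i (Z \<omega>) \<partial>\<Omega>) =
          (\<integral>\<^sup>+\<omega>. indicator {\<omega> \<in> space \<Omega>. R \<omega> \<le> U \<omega>} \<omega> \<partial>\<Omega>)"
        using i by (intro nn_integral_cong) (auto simp: f_def B_def Z_def indicator_def)
      ultimately show "(\<integral>\<^sup>+\<omega>. f k i (Z \<omega>) \<partial>\<Omega>) = emeasure \<Omega> {\<omega> \<in> space \<Omega>. R \<omega> \<le> U \<omega>}"
        by simp
    qed simp
    finally show "(\<integral>\<^sup>+\<omega>. (\<Prod>i\<le>k. f k i (Y i \<omega>)) \<partial>\<Omega>') =
        emeasure \<Omega> {\<omega> \<in> space \<Omega>. R \<omega> \<le> U \<omega>} ^ k * mean \<Omega> (\<lambda>\<omega>. min (U \<omega>) (R \<omega>))"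
      by (simp add: f_def c_def Z_def mean_def)
  qed
  finally show ?thesis by simp
qed

section \<open>Sharp restart of the cycle trap process\<close>

text \<open>With \<open>\<mu> = l + k * (1 - p) / p\<close>, the mean of \<open>l + G * k\<close>
  for geometric \<open>G\<close>, the right side is \<open>\<mu>\<close> minus the tail
  \<open>(1 - p) ^ n * (\<mu> + real n * k)\<close> predicted by memorylessness.\<close>

lemma geometric_weights_sum_cycles:
  fixes p l k :: real
  assumes "p \<noteq> 0"
  shows "(\<Sum>g<n. (1 - p) ^ g * p * (l + real g * k)) =
    (1 - (1 - p) ^ n) * (l + k * (1 - p) / p) - (1 - p) ^ n * (real n * k)"
proof (induction n)
  case (Suc n)
  define \<mu> where "\<mu> = l + k * (1 - p) / p"
  \<comment> \<open>Clearing the denominator of \<open>\<mu>\<close> makes the induction step a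
    polynomial identity.\<close>
  have "p * \<mu> = p * l + k * (1 - p)" using assms by (simp add: \<mu>_def distrib_left)
  then have "(1 - p) ^ n * (p * \<mu>) = (1 - p) ^ n * (p * l + k * (1 - p))" by simp
  with Suc show ?case unfolding \<mu>_def[symmetric] by (simp add: algebra_simps)
qed simp

lemma geometric_weights_sums_tail:
  fixes p c :: real
  assumes "p \<in> {0<..1}"
  shows "(\<lambda>g. (1 - p) ^ (g + n) * p * c) sums ((1 - p) ^ n * c)"
proof -
  have "(\<lambda>g. (1 - p) ^ g) sums (1 / (1 - (1 - p)))"
    using assms by (intro geometric_sums) auto
  then have "(\<lambda>g. (1 - p) ^ n * p * c * (1 - p) ^ g) sums ((1 - p) ^ n * p * c * (1 / p))"
    by (intro sums_mult) simp
  then show ?thesis using assms by (simp add: power_add mult_ac)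
qed

lemma geometric_weights_sums_cycles:
  fixes p l k :: real
  assumes "p \<in> {0<..1}"
  shows "(\<lambda>g. (1 - p) ^ g * p * (l + real g * k)) sums (l + k * (1 - p) / p)"
proof -
  have "(\<lambda>g. (1 - p) ^ g * p * l + p * k * ((1 - p) ^ g * real g))
      sums (l + p * k * ((1 - p) / (1 - (1 - p))\<^sup>2))"
    using geometric_weights_sums_tail[OF assms, of 0 l] assms
    by (intro sums_add sums_mult geometric_sums_times_n) auto
  moreover have "p * k * ((1 - p) / (1 - (1 - p))\<^sup>2) = k * (1 - p) / p"
    using assms by (simp add: power2_eq_square)
  ultimately show ?thesis by (simp add: algebra_simps)
qed

text \<open>\<open>N\<close> lies strictly above \<open>L + b * (M + 1)\<close> and at most at
  \<open>L + (b + 1) * (M + 1)\<close>. The last value of a block ties with a possible hitting time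
  and so counts as a restart, which is why blocks begin at \<open>L + 1\<close>.\<close>

lemma cycle_block_threshold:
  fixes N L M b r g :: nat
  assumes "N = (L + 1) + b * (M + 1) + r" and "r < M + 1"
  shows "N \<le> L + g * (M + 1) \<longleftrightarrow> b < g"
proof (cases "b < g")
  case True
  then have "(b + 1) * (M + 1) \<le> g * (M + 1)" by (intro mult_le_mono1) simp
  with True assms show ?thesis by simp
next
  case False
  then have "g * (M + 1) \<le> b * (M + 1)" by (intro mult_le_mono1) simp
  with False assms show ?thesis by linarith
qed

section \<open>Means of the cycle trap process with and without restart\<close>

context
  fixes L M :: nat and p :: real and \<Omega> :: "'a measure" and X :: "nat \<Rightarrow> 'a \<Rightarrow> int"
  assumes L: "L \<ge> 1" and M: "M \<ge> 1" and p: "p \<in> {0<..1}"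
    and proc: "cycle_trap_process \<Omega> p L M X"
begin

private abbreviation (input) "U \<equiv> hitting_time X (- int L)"

lemma measurable_cycle_trap_hitting_time: "U \<in> measurable \<Omega> (count_space UNIV)"
  using proc by (intro measurable_hitting_time) (simp add: markov_chain_def)

text \<open>The law of \<open>U\<close> is carried by the values \<open>L + g * (M + 1)\<close>, so
  expectations of functions of \<open>U\<close> become series with geometric weights.\<close>

lemma nn_integral_cycle_trap_hitting_time:
  assumes f: "\<And>g. f (enat (L + g * (M + 1))) = ennreal (h g)" and nonneg: "\<And>g. h g \<ge> 0"
    and sums: "(\<lambda>g. (1 - p) ^ g * p * h g) sums x"
  shows "(\<integral>\<^sup>+\<omega>. f (U \<omega>) \<partial>\<Omega>) = ennreal x"
proof -
  have "(\<integral>\<^sup>+\<omega>. f (U \<omega>) \<partial>\<Omega>) = (\<integral>\<^sup>+t. f t \<partial>distr \<Omega> (count_space UNIV) U)"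
    by (rule nn_integral_distr[symmetric]) (use measurable_cycle_trap_hitting_time in auto)
  also have "\<dots> = (\<integral>\<^sup>+g. ennreal (h g) \<partial>measure_pmf (geometric_pmf p))"
    unfolding distr_hitting_time_cycle_trap[OF L M p proc] nn_integral_map_pmf f ..
  also have "\<dots> = (\<Sum>g. ennreal ((1 - p) ^ g * p * h g))"
    using p nonneg
    by (simp add: nn_integral_measure_pmf nn_integral_count_space_nat ennreal_mult[symmetric])
  also have "\<dots> = ennreal x"
    using p nonneg sums by (intro suminf_ennreal_eq) auto
  finally show ?thesis .
qed

lemma mean_cycle_trap_hitting_time:
  "mean \<Omega> U = ennreal (real L + real (M + 1) * (1 - p) / p)"
  unfolding mean_def
proof (rule nn_integral_cycle_trap_hitting_time)
  show "ennreal_of_enat (enat (L + g * (M + 1))) = ennreal (real L + real g * real (M + 1))" for g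
    by (simp only: ennreal_of_enat_enat ennreal_of_nat_eq_real_of_nat of_nat_add of_nat_mult)
qed (simp, rule geometric_weights_sums_cycles[OF p])

text \<open>If \<open>N = (L + 1) + b * (M + 1) + r\<close>, it lies in the \<open>b\<close>-th block of \<open>M + 1\<close> restart
  times, so that an attempt succeeds iff it makes at most \<open>b\<close> cycles.\<close>

lemma emeasure_cycle_trap_hitting_time_ge:
  assumes N: "N = (L + 1) + b * (M + 1) + r" and r: "r < M + 1"
  shows "emeasure \<Omega> {\<omega> \<in> space \<Omega>. enat N \<le> U \<omega>} = ennreal ((1 - p) ^ (b + 1))"
proof -
  let ?h = "\<lambda>g. if g < b + 1 then 0 else 1 :: real"
  have meas: "{\<omega> \<in> space \<Omega>. enat N \<le> U \<omega>} \<in> sets \<Omega>"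
    using measurable_sets[OF measurable_cycle_trap_hitting_time, of "{enat N..}"]
    by (simp add: vimage_def Int_def conj_commute)
  have "emeasure \<Omega> {\<omega> \<in> space \<Omega>. enat N \<le> U \<omega>} =
      (\<integral>\<^sup>+\<omega>. indicator {\<omega> \<in> space \<Omega>. enat N \<le> U \<omega>} \<omega> \<partial>\<Omega>)"
    using meas by simp
  also have "\<dots> = (\<integral>\<^sup>+\<omega>. indicator {enat N..} (U \<omega>) \<partial>\<Omega>)"
    by (intro nn_integral_cong) (auto simp: indicator_def)
  also have "\<dots> = ennreal ((1 - p) ^ (b + 1))"
  proof (rule nn_integral_cycle_trap_hitting_time)
    fix g
    show "indicator {enat N..} (enat (L + g * (M + 1))) = ennreal (?h g)"
      using cycle_block_threshold[OF N r, of g] by (auto simp: indicator_def)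
    show "?h g \<ge> 0" by simp
  next
    \<comment> \<open>The first \<open>b + 1\<close> terms vanish, so shifting the index leaves the
      sum unchanged.\<close>
    have "(\<lambda>g. (1 - p) ^ (g + (b + 1)) * p * ?h (g + (b + 1))) sums ((1 - p) ^ (b + 1))"
      using geometric_weights_sums_tail[OF p, of "b + 1" 1] by simp
    then show "(\<lambda>g. (1 - p) ^ g * p * ?h g) sums ((1 - p) ^ (b + 1))"
      using sums_iff_shift[of "\<lambda>g. (1 - p) ^ g * p * ?h g" "b + 1"] by simp
  qed
  finally show ?thesis .
qed

text \<open>Attempts with at most \<open>b\<close> cycles contribute the truncated geometric mean,
  and the others contribute \<open>N\<close> with total weight
  \<open>(1 - p) ^ (b + 1)\<close>.\<close>

lemma mean_min_cycle_trap_hitting_time: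
  assumes N: "N = (L + 1) + b * (M + 1) + r" and r: "r < M + 1"
  shows "mean \<Omega> (\<lambda>\<omega>. min (U \<omega>) (enat N)) =
    ennreal ((1 - (1 - p) ^ (b + 1)) * (real L + real (M + 1) * (1 - p) / p) +
      (1 - p) ^ (b + 1) * (real L + real r - real M))"
  unfolding mean_def
proof (rule nn_integral_cycle_trap_hitting_time)
  let ?h = "\<lambda>g. real (min (L + g * (M + 1)) N)"
  show "ennreal_of_enat (min (enat (L + g * (M + 1))) (enat N)) = ennreal (?h g)" for g
    by (simp only: min_enat_simps ennreal_of_enat_enat ennreal_of_nat_eq_real_of_nat)
  show "?h g \<ge> 0" for g by simp
  have below: "?h g = real L + real g * real (M + 1)" if "g < b + 1" for g
    using cycle_block_threshold[OF N r, of g] that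
    by (subst min_absorb1) (simp_all add: algebra_simps)
  have above: "?h (g + (b + 1)) = real N" for g
    using cycle_block_threshold[OF N r, of "g + (b + 1)"]
    by (subst min_absorb2) simp_all
  have "(\<Sum>g<b + 1. (1 - p) ^ g * p * ?h g) =
      (\<Sum>g<b + 1. (1 - p) ^ g * p * (real L + real g * real (M + 1)))"
    by (intro sum.cong) (simp_all only: below lessThan_iff)
  also have "\<dots> = (1 - (1 - p) ^ (b + 1)) * (real L + real (M + 1) * (1 - p) / p) -
      (1 - p) ^ (b + 1) * (real (b + 1) * real (M + 1))"
    using p by (intro geometric_weights_sum_cycles) auto
  finally have head: "(\<Sum>g<b + 1. (1 - p) ^ g * p * ?h g) = \<dots>" .
  \<comment> \<open>This is the time lost by restarting at \<open>N\<close> instead of at the end of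
    cycle \<open>b + 1\<close>, when the process is back at \<open>0\<close>; its sign decides the
    theorem.\<close>
  have "real N - real (b + 1) * real (M + 1) = real L + real r - real M"
    unfolding N by (simp add: algebra_simps)
  then have N': "real N = real L + real r - real M + real (b + 1) * real (M + 1)" by simp
  have "(\<lambda>g. (1 - p) ^ (g + (b + 1)) * p * ?h (g + (b + 1))) sums ((1 - p) ^ (b + 1) * real N)"
    unfolding above by (rule geometric_weights_sums_tail[OF p])
  then have "(\<lambda>g. (1 - p) ^ g * p * ?h g) sums
      ((1 - p) ^ (b + 1) * real N + (\<Sum>g<b + 1. (1 - p) ^ g * p * ?h g))"
    by (rule iffD1[OF sums_iff_shift])
  also have "(1 - p) ^ (b + 1) * real N + (\<Sum>g<b + 1. (1 - p) ^ g * p * ?h g) =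
      (1 - (1 - p) ^ (b + 1)) * (real L + real (M + 1) * (1 - p) / p) +
      (1 - p) ^ (b + 1) * (real L + real r - real M)"
    unfolding head N' by (simp only: distrib_left)
  finally show "(\<lambda>g. (1 - p) ^ g * p * ?h g) sums \<dots>" .
qed

text \<open>The restart probabilities form a geometric series with sum \<open>1 / (1 - ?s)\<close>.
  Multiplied by the mean of one attempt it leaves \<open>?\<mu>\<close> plus a correction with the
  sign of \<open>?d\<close>, or zero.\<close>

lemma mean_sharp_restart_cycle_trap:
  assumes restart: "passage_time_under_sharp_restart \<Omega> U N \<Omega>' T"
    and N: "N = (L + 1) + b * (M + 1) + r" and r: "r < M + 1"
  shows "mean \<Omega>' T = ennreal (real L + real (M + 1) * (1 - p) / p +
    (1 - p) ^ (b + 1) * (real L + real r - real M) / (1 - (1 - p) ^ (b + 1)))"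
proof -
  let ?\<mu> = "real L + real (M + 1) * (1 - p) / p" and ?s = "(1 - p) ^ (b + 1)"
  let ?d = "real L + real r - real M"
  have s: "0 \<le> ?s" "?s < 1" using p by (auto simp: power_less_one_iff simp del: power_Suc)
  have "prob_space \<Omega>" using proc by (simp add: markov_chain_def)
  moreover have "AE \<omega> in \<Omega>. enat N > 0" using N by (simp add: zero_enat_def)
  ultimately have "mean \<Omega>' T = (\<Sum>k. ennreal ?s ^ k) * ennreal ((1 - ?s) * ?\<mu> + ?s * ?d)"
    using mean_passage_time_under_restart[OF _ measurable_cycle_trap_hitting_time _ _ restart]
    by (simp only: emeasure_cycle_trap_hitting_time_ge[OF N r]
        mean_min_cycle_trap_hitting_time[OF N r]) simp
  also have "(\<Sum>k. ennreal ?s ^ k) = ennreal (1 / (1 - ?s))"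
    using s by (simp only: ennreal_power) (intro suminf_ennreal_eq geometric_sums, auto)
  \<comment> \<open>The rule asks only for a nonnegative first factor; \<open>?d\<close> may be
    negative.\<close>
  also have "\<dots> * ennreal ((1 - ?s) * ?\<mu> + ?s * ?d) = ennreal (1 / (1 - ?s) * ((1 - ?s) * ?\<mu> + ?s * ?d))"
    using s by (intro ennreal_mult'[symmetric]) simp
  also have "1 / (1 - ?s) * ((1 - ?s) * ?\<mu> + ?s * ?d) = ?\<mu> + ?s * ?d / (1 - ?s)"
    using s by (simp only: distrib_left) simp
  finally show ?thesis .
qed

text \<open>Almost surely \<open>U\<close> is at least \<open>L\<close>, so every attempt is
  restarted and the series sums infinitely many ones.\<close>

lemma mean_preemptive_sharp_restart_cycle_trap:
  assumes restart: "passage_time_under_sharp_restart \<Omega> U N \<Omega>' T"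
    and "N \<ge> 1" and "N \<le> L"
  shows "mean \<Omega>' T = \<infinity>"
proof -
  interpret prob_space \<Omega> using proc by (simp add: markov_chain_def)
  have "AE t in distr \<Omega> (count_space UNIV) U. enat N \<le> t"
    unfolding distr_hitting_time_cycle_trap[OF L M p proc]
    using \<open>N \<le> L\<close> by (auto simp: AE_measure_pmf_iff)
  then have ge: "AE \<omega> in \<Omega>. enat N \<le> U \<omega>"
    by (subst (asm) AE_distr_iff) (use measurable_cycle_trap_hitting_time in auto)
  then have "emeasure \<Omega> {\<omega> \<in> space \<Omega>. enat N \<le> U \<omega>} = 1"
    using measurable_sets[OF measurable_cycle_trap_hitting_time, of "{enat N..}"]
    by (intro emeasure_eq_1_AE) (auto simp: vimage_def Int_def conj_commute)
  moreover have "mean \<Omega> (\<lambda>\<omega>. min (U \<omega>) (enat N)) = (\<integral>\<^sup>+\<omega>. of_nat N \<partial>\<Omega>)"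
    unfolding mean_def using ge by (intro nn_integral_cong_AE) (auto simp: min_absorb2)
  moreover have "(\<Sum>k. 1 :: ennreal) = \<infinity>"
    using nn_integral_count_space_nat[of "\<lambda>_. 1"] by simp
  moreover have "AE \<omega> in \<Omega>. enat N > 0" using \<open>N \<ge> 1\<close> by (simp add: zero_enat_def)
  \<comment> \<open>Here \<open>N \<ge> 1\<close> excludes the product of \<infinity> and
    \<open>0\<close>, which is \<open>0\<close> in \<open>ennreal\<close>.\<close>
  ultimately show ?thesis
    using mean_passage_time_under_restart[OF prob_space_axioms
        measurable_cycle_trap_hitting_time _ _ restart] \<open>N \<ge> 1\<close>
    by (simp add: emeasure_space_1 ennreal_top_mult)
qed

end

text \<open>Strictness beyond \<open>N = L\<close> carries \<open>q \<noteq> 0\<close>: if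
  \<open>q = 0\<close>, then \<open>U\<close> equals \<open>L\<close> almost surely, a restart time
  above \<open>L\<close> never takes effect, and the means coincide.\<close>

theorem mainTheorem7:
  fixes L M :: nat and p q :: real
    and \<Omega> :: "'a measure" and X :: "nat \<Rightarrow> 'a \<Rightarrow> int" and U :: "'a \<Rightarrow> enat"
    and \<Omega>' :: "nat \<Rightarrow> 'b measure" and T :: "nat \<Rightarrow> 'b \<Rightarrow> enat"
  assumes "L \<ge> 1" and "M \<ge> 1"
    and "p \<in> {0..1}" and "q = 1 - p" and "q \<noteq> 1"
    and "cycle_trap_process \<Omega> p L M X"
    and "U = hitting_time X (- int L)"
    and "\<And>N. N \<ge> 1 \<Longrightarrow> passage_time_under_sharp_restart \<Omega> U N (\<Omega>' N) (T N)"
  shows "(L \<ge> M \<longrightarrow> (\<forall>N\<ge>1. mean (\<Omega>' N) (T N) \<ge> mean \<Omega> U)) \<and>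
    (L > M \<longrightarrow> (\<forall>N\<ge>1. N \<le> L \<or> q \<noteq> 0 \<longrightarrow> mean (\<Omega>' N) (T N) > mean \<Omega> U)) \<and>
    (L < M \<longrightarrow>
      (\<forall>b r N. r < M + 1 \<and> N = (L + 1) + b * (M + 1) + r \<longrightarrow>
         (r < M - L \<and> q \<noteq> 0 \<longrightarrow> mean (\<Omega>' N) (T N) < mean \<Omega> U) \<and>
         (r = M - L \<longrightarrow> mean (\<Omega>' N) (T N) = mean \<Omega> U) \<and>
         (r > M - L \<and> q \<noteq> 0 \<longrightarrow> mean (\<Omega>' N) (T N) > mean \<Omega> U)))"
proof -
  let ?\<mu> = "real L + real (M + 1) * (1 - p) / p"
  have p: "p \<in> {0<..1}" using assms(3-5) by auto
  have meanU: "mean \<Omega> U = ennreal ?\<mu>"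
    unfolding assms(7) by (rule mean_cycle_trap_hitting_time[OF assms(1,2) p assms(6)])
  \<comment> \<open>Since \<open>ennreal\<close> sends negative reals to \<open>0\<close>, strict
    comparisons need a positive larger side.\<close>
  have "?\<mu> \<ge> real L" using p by simp
  then have \<mu>: "?\<mu> > 0" using assms(1) by linarith
  have early: "mean (\<Omega>' N) (T N) > mean \<Omega> U" if "N \<ge> 1" "N \<le> L" for N
    using mean_preemptive_sharp_restart_cycle_trap[OF assms(1,2) p assms(6)
        assms(8)[unfolded assms(7)] that] that
    by (simp add: meanU)
  \<comment> \<open>All four comparisons below depend only on the sign of \<open>L + r - M\<close>;
    the witness is \<open>s / (1 - s)\<close> with \<open>s = (1 - p) ^ (b + 1)\<close>.\<close>
  have diff: "\<exists>c\<ge>0. (q \<noteq> 0 \<longrightarrow> c > 0) \<and>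
      mean (\<Omega>' N) (T N) = ennreal (?\<mu> + c * (real L + real r - real M))"
    if N: "N = (L + 1) + b * (M + 1) + r" and r: "r < M + 1" for N b r
  proof -
    have "N \<ge> 1" using N by simp
    then have "mean (\<Omega>' N) (T N) = ennreal (?\<mu> +
        (1 - p) ^ (b + 1) * (real L + real r - real M) / (1 - (1 - p) ^ (b + 1)))"
      using mean_sharp_restart_cycle_trap[OF assms(1,2) p assms(6)
        assms(8)[unfolded assms(7)] N r] by blast
    moreover have "0 \<le> (1 - p) ^ (b + 1)" "(1 - p) ^ (b + 1) < 1"
      using p by (auto simp: power_less_one_iff simp del: power_Suc)
    ultimately show ?thesis
      using p assms(4) by (intro exI[of _ "(1 - p) ^ (b + 1) / (1 - (1 - p) ^ (b + 1))"]) auto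
  qed
  have less: "mean (\<Omega>' N) (T N) < mean \<Omega> U"
    if N: "N = (L + 1) + b * (M + 1) + r" "r < M + 1" and sgn: "q \<noteq> 0" "L + r < M" for N b r
  proof -
    obtain c where c: "c > 0" "mean (\<Omega>' N) (T N) = ennreal (?\<mu> + c * (real L + real r - real M))"
      using diff[OF N] sgn(1) by auto
    have "c * (real L + real r - real M) < 0" using c(1) sgn(2) by (intro mult_pos_neg) auto
    then show ?thesis unfolding c(2) meanU using \<mu> by (intro ennreal_lessI) auto
  qed
  have greater: "mean (\<Omega>' N) (T N) > mean \<Omega> U"
    if N: "N = (L + 1) + b * (M + 1) + r" "r < M + 1" and sgn: "q \<noteq> 0" "L + r > M" for N b r
  proof -
    obtain c where c: "c > 0" "mean (\<Omega>' N) (T N) = ennreal (?\<mu> + c * (real L + real r - real M))"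
      using diff[OF N] sgn(1) by auto
    have "c * (real L + real r - real M) > 0" using c(1) sgn(2) by (intro mult_pos_pos) auto
    then show ?thesis unfolding c(2) meanU using \<mu> by (intro ennreal_lessI) auto
  qed
  have ge: "mean (\<Omega>' N) (T N) \<ge> mean \<Omega> U"
    if N: "N = (L + 1) + b * (M + 1) + r" "r < M + 1" and sgn: "L + r \<ge> M" for N b r
  proof -
    obtain c where c: "c \<ge> 0" "mean (\<Omega>' N) (T N) = ennreal (?\<mu> + c * (real L + real r - real M))"
      using diff[OF N] by auto
    have "c * (real L + real r - real M) \<ge> 0" using c(1) sgn by (intro mult_nonneg_nonneg) auto
    then show ?thesis unfolding c(2) meanU by (intro ennreal_leI) auto
  qed
  have equal: "mean (\<Omega>' N) (T N) = mean \<Omega> U"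
    if "N = (L + 1) + b * (M + 1) + r" "r < M + 1" "L + r = M" for N b r
    using diff[OF that(1,2)] that(3) by (auto simp: meanU)
  \<comment> \<open>Quotient and remainder of \<open>N - (L + 1)\<close> by
    \<open>M + 1\<close>.\<close>
  have block: "\<exists>b r. N = (L + 1) + b * (M + 1) + r \<and> r < M + 1" if "\<not> N \<le> L" for N
  proof (intro exI conjI)
    show "N = (L + 1) + (N - (L + 1)) div (M + 1) * (M + 1) + (N - (L + 1)) mod (M + 1)"
      using that by (simp only: add.assoc div_mult_mod_eq)
  qed simp
  show ?thesis
  proof (intro conjI allI impI)
    fix N :: nat assume "L \<ge> M" "N \<ge> 1"
    then show "mean (\<Omega>' N) (T N) \<ge> mean \<Omega> U"
      using early[of N] block[of N] ge by (cases "N \<le> L") (auto intro: less_imp_le)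
  next
    fix N :: nat assume "L > M" "N \<ge> 1" "N \<le> L \<or> q \<noteq> 0"
    then show "mean (\<Omega>' N) (T N) > mean \<Omega> U"
      using early[of N] block[of N] greater by (cases "N \<le> L") auto
  next
    fix b r N :: nat
    assume "L < M" and block: "r < M + 1 \<and> N = (L + 1) + b * (M + 1) + r"
    show "mean (\<Omega>' N) (T N) < mean \<Omega> U" if "r < M - L \<and> q \<noteq> 0"
      using block that by (intro less[of N b r]) auto
    \<comment> \<open>\<open>L < M\<close> keeps the natural subtraction from truncating, so
      \<open>L + r = M\<close>.\<close>
    show "mean (\<Omega>' N) (T N) = mean \<Omega> U" if "r = M - L"
      using block that \<open>L < M\<close> by (intro equal[of N b r]) auto
    show "mean (\<Omega>' N) (T N) > mean \<Omega> U" if "r > M - L \<and> q \<noteq> 0"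
      using block that by (intro greater[of N b r]) auto
  qed
qed

end
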